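(* Let $S=\{s_1,\dots,s_k\}$ be a finite set of steps (with this fixed ordering), $U$ a finite set of users, and for each $u\in U$ let $A(u)\subseteq S$ be the set of steps for which $u$ is authorised; write $A^{-1}(s)=\{u\in U : s\in A(u)\}$. Let $P=(x_1,\dots,x_k)$ be a complete pattern, let $X=\{x_i : i=1,\dots,k\}$, and for each $x\in X$ let $P^{-1}(x)=\{s_i\in S : x_i=x\}$. Let $G=(X\cup U,E)$ be the bipartite graph in which, for $x\in X$ and $u\in U$, $(x,u)\in E$ if and only if $u\in A^{-1}(s)$ for every $s\in P^{-1}(x)$. Then $P$ is authorised if and only if $G$ has a matching of size $|X|$.
   Context: A plan is a function $\pi:T\to U$ with $T\subseteq S$; it is a complete plan if $T=S$. A plan $\pi:T\to U$ is authorised if $s\in A(\pi(s))$ for every $s\in T$. The pattern of a plan $\pi:T\to U$ is $P(\pi)=(x_1,\dots,x_k)$ defined recursively by: $x_i=0$ if $s_i\notin T$; $x_1=1$ if $s_1\in T$; $x_i=x_j$ if $\pi(s_i)=\pi(s_j)$ for some $j<i$ (with $s_j\in T$); and otherwise $x_i=\max\{x_1,\dots,x_{i-1}\}+1$. A pattern is any tuple of the form $P(\pi)$; it is complete if all its entries are nonzero (equivalently it is the pattern of a complete plan). A pattern $P$ is authorised if there exists an authorised plan $\pi$ with $P(\pi)=P$. *)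

theory Defs
  imports Main
begin

text \<open>
  The ordered set of steps \<open>s\<^sub>1, \<dots>, s\<^sub>k\<close> is a distinct list \<open>ss\<close>, indexed from \<open>0\<close>, so that
  \<open>s\<^sub>i\<close> is \<open>ss ! (i - 1)\<close>. A plan \<open>T \<rightarrow> U\<close> is a partial map whose domain is \<open>T\<close>.
\<close>

definition is_plan :: "'s list \<Rightarrow> 'u set \<Rightarrow> ('s \<rightharpoonup> 'u) \<Rightarrow> bool" where
  "is_plan ss U \<pi> \<longleftrightarrow> dom \<pi> \<subseteq> set ss \<and> ran \<pi> \<subseteq> U"

definition authorised_plan :: "('u \<Rightarrow> 's set) \<Rightarrow> ('s \<rightharpoonup> 'u) \<Rightarrow> bool" where
  "authorised_plan A \<pi> \<longleftrightarrow> (\<forall>s\<in>dom \<pi>. s \<in> A (the (\<pi> s)))"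

text \<open>
  The clause ``\<open>x\<^sub>i = x\<^sub>j\<close> if \<open>\<pi>(s\<^sub>i) = \<pi>(s\<^sub>j)\<close> for some \<open>j < i\<close>'' is made into a recursion
  equation by taking the least such \<open>j\<close>; lemma \<open>pattern_entry_same\<close> below shows that every
  such \<open>j\<close> gives the same value.
\<close>

function pattern_entry :: "'s list \<Rightarrow> ('s \<rightharpoonup> 'u) \<Rightarrow> nat \<Rightarrow> nat" where
  "pattern_entry ss \<pi> i =
     (if ss ! i \<notin> dom \<pi> then 0
      else if i = 0 then 1
      else if \<exists>j<i. ss ! j \<in> dom \<pi> \<and> \<pi> (ss ! i) = \<pi> (ss ! j)
        then pattern_entry ss \<pi> (LEAST j. j < i \<and> ss ! j \<in> dom \<pi> \<and> \<pi> (ss ! i) = \<pi> (ss ! j))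
      else Max ((\<lambda>j. pattern_entry ss \<pi> j) ` {..<i}) + 1)"
  by pat_completeness auto
termination
proof (relation "measure (\<lambda>(ss, \<pi>, i). i)", goal_cases)
  case (2 ss \<pi> i)
  then obtain j where "j < i \<and> ss ! j \<in> dom \<pi> \<and> \<pi> (ss ! i) = \<pi> (ss ! j)" by blast
  from LeastI[of "\<lambda>j. j < i \<and> ss ! j \<in> dom \<pi> \<and> \<pi> (ss ! i) = \<pi> (ss ! j)", OF this]
  show ?case by simp
qed auto

declare pattern_entry.simps [simp del]

definition pattern :: "'s list \<Rightarrow> ('s \<rightharpoonup> 'u) \<Rightarrow> nat list" where
  "pattern ss \<pi> = map (pattern_entry ss \<pi>) [0..<length ss]"

definition is_pattern :: "'s list \<Rightarrow> 'u set \<Rightarrow> nat list \<Rightarrow> bool" where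
  "is_pattern ss U P \<longleftrightarrow> (\<exists>\<pi>. is_plan ss U \<pi> \<and> pattern ss \<pi> = P)"

definition complete_pattern :: "'s list \<Rightarrow> 'u set \<Rightarrow> nat list \<Rightarrow> bool" where
  "complete_pattern ss U P \<longleftrightarrow> is_pattern ss U P \<and> (\<forall>x\<in>set P. x \<noteq> 0)"

definition authorised_pattern ::
    "'s list \<Rightarrow> 'u set \<Rightarrow> ('u \<Rightarrow> 's set) \<Rightarrow> nat list \<Rightarrow> bool" where
  "authorised_pattern ss U A P \<longleftrightarrow>
     (\<exists>\<pi>. is_plan ss U \<pi> \<and> authorised_plan A \<pi> \<and> pattern ss \<pi> = P)"

definition authorised_users :: "'u set \<Rightarrow> ('u \<Rightarrow> 's set) \<Rightarrow> 's \<Rightarrow> 'u set" where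
  "authorised_users U A s = {u \<in> U. s \<in> A u}"

definition pattern_block :: "'s list \<Rightarrow> nat list \<Rightarrow> nat \<Rightarrow> 's set" where
  "pattern_block ss P x = {ss ! i |i. i < length ss \<and> P ! i = x}"

text \<open>
  An undirected graph is a pair of a vertex set and a set of edges, each edge being the set of
  its endpoints. The vertex set \<open>X \<union> U\<close> of the bipartite graph is a disjoint union.
\<close>

type_synonym 'v ugraph = "'v set \<times> 'v set set"

definition pattern_graph ::
    "'s list \<Rightarrow> 'u set \<Rightarrow> ('u \<Rightarrow> 's set) \<Rightarrow> nat list \<Rightarrow> (nat + 'u) ugraph" where
  "pattern_graph ss U A P =
     (set P <+> U,
      {{Inl x, Inr u} |x u. x \<in> set P \<and> u \<in> U \<and>
         (\<forall>s\<in>pattern_block ss P x. u \<in> authorised_users U A s)})"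

definition is_matching :: "'v ugraph \<Rightarrow> 'v set set \<Rightarrow> bool" where
  "is_matching G M \<longleftrightarrow> M \<subseteq> snd G \<and> pairwise disjnt M"

lemma pattern_entry_notin: "ss ! i \<notin> dom \<pi> \<Longrightarrow> pattern_entry ss \<pi> i = 0"
  by (subst pattern_entry.simps) simp

lemma pattern_entry_first: "ss ! 0 \<in> dom \<pi> \<Longrightarrow> pattern_entry ss \<pi> 0 = 1"
  by (subst pattern_entry.simps) simp

lemma pattern_entry_same:
  assumes "j < i" "ss ! j \<in> dom \<pi>" "\<pi> (ss ! i) = \<pi> (ss ! j)"
  shows "pattern_entry ss \<pi> i = pattern_entry ss \<pi> j"
proof -
  define m where "m = (LEAST j. ss ! j \<in> dom \<pi> \<and> \<pi> (ss ! i) = \<pi> (ss ! j))"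
  have m: "ss ! m \<in> dom \<pi> \<and> \<pi> (ss ! i) = \<pi> (ss ! m)"
    unfolding m_def by (rule LeastI[of _ j]) (use assms in auto)
  have least: "m \<le> l" if "ss ! l \<in> dom \<pi>" "\<pi> (ss ! i) = \<pi> (ss ! l)" for l
    unfolding m_def by (rule Least_le) (use that in auto)
  have key: "pattern_entry ss \<pi> l = pattern_entry ss \<pi> m"
    if l: "ss ! l \<in> dom \<pi>" "\<pi> (ss ! l) = \<pi> (ss ! i)" for l
  proof (cases "l = m")
    case False
    have "m \<le> l" by (rule least) (use l in simp_all)
    with False have "m < l" by simp
    have "(LEAST j. j < l \<and> ss ! j \<in> dom \<pi> \<and> \<pi> (ss ! l) = \<pi> (ss ! j)) = m"
      by (rule Least_equality) (use \<open>m < l\<close> m l least in auto)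
    with \<open>m < l\<close> m l show ?thesis
      by (subst pattern_entry.simps) auto
  qed simp
  have "ss ! i \<in> dom \<pi>" using assms by (auto simp: dom_def)
  then show ?thesis using key[of i] key[of j] assms by simp
qed

lemma pattern_entry_new:
  assumes "0 < i" "ss ! i \<in> dom \<pi>"
    and "\<And>j. j < i \<Longrightarrow> ss ! j \<in> dom \<pi> \<Longrightarrow> \<pi> (ss ! i) \<noteq> \<pi> (ss ! j)"
  shows "pattern_entry ss \<pi> i = Max (pattern_entry ss \<pi> ` {..<i}) + 1"
  using assms by (subst pattern_entry.simps) auto

end

theory Submission
  imports Defs
begin

text \<open>
  Two steps of a plan get the same pattern entry iff they are assigned to the same user, and a
  complete pattern depends only on which steps share a user. Hence a plan realising \<open>P\<close> amounts to
  an injective choice of a user for every value \<open>x\<close> of \<open>P\<close>; it is authorised iff each chosen user is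
  authorised for all of \<open>P\<^sup>-\<^sup>1(x)\<close>, that is, iff the choice is a matching of \<open>G\<close> saturating \<open>X\<close>.
\<close>

text \<open>If the user of step \<open>i\<close> already occurs at some \<open>m < i\<close>, then
  \<open>m\<close> and \<open>j\<close> have equal entries and both lie below \<open>i\<close>, so
  the induction hypothesis applies to that pair. Otherwise entry \<open>i\<close> exceeds all
  earlier ones, which excludes equality with entry \<open>j\<close>.\<close>

lemma pattern_entry_eq_imp_same_user:
  assumes "j < i" "ss ! i \<in> dom \<pi>" "ss ! j \<in> dom \<pi>"
    and "pattern_entry ss \<pi> i = pattern_entry ss \<pi> j"
  shows "\<pi> (ss ! i) = \<pi> (ss ! j)"
  using assms
proof (induction i arbitrary: j rule: less_induct)
  case (less i)
  show ?case
  proof (cases "\<exists>m<i. ss ! m \<in> dom \<pi> \<and> \<pi> (ss ! i) = \<pi> (ss ! m)")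
    case True
    then obtain m where m: "m < i" "ss ! m \<in> dom \<pi>" "\<pi> (ss ! i) = \<pi> (ss ! m)" by blast
    have e: "pattern_entry ss \<pi> m = pattern_entry ss \<pi> j"
      using pattern_entry_same[OF m] less.prems by simp
    \<comment> \<open>The induction hypothesis takes the larger index first, so the order of
      \<open>m\<close> and \<open>j\<close> decides which of them plays that role.\<close>
    consider "m < j" | "m = j" | "j < m" by linarith
    then have "\<pi> (ss ! m) = \<pi> (ss ! j)"
    proof cases
      case 1
      from less.IH[OF less.prems(1) 1 less.prems(3) m(2) e[symmetric]] show ?thesis by simp
    next
      case 3
      from less.IH[OF m(1) 3 m(2) less.prems(3) e] show ?thesis .
    qed simp
    with m show ?thesis by simp
  next
    case False
    then have "pattern_entry ss \<pi> i = Max (pattern_entry ss \<pi> ` {..<i}) + 1"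
      using less.prems by (intro pattern_entry_new) auto
    moreover have "pattern_entry ss \<pi> j \<le> Max (pattern_entry ss \<pi> ` {..<i})"
      using less.prems by (intro Max_ge) auto
    ultimately show ?thesis using less.prems by simp
  qed
qed

lemma pattern_entry_eq_iff:
  assumes "ss ! i \<in> dom \<pi>" "ss ! j \<in> dom \<pi>"
  shows "pattern_entry ss \<pi> i = pattern_entry ss \<pi> j \<longleftrightarrow> \<pi> (ss ! i) = \<pi> (ss ! j)"
  using assms pattern_entry_eq_imp_same_user[of i j ss \<pi>] pattern_entry_eq_imp_same_user[of j i ss \<pi>]
    pattern_entry_same[of i j ss \<pi>] pattern_entry_same[of j i ss \<pi>]
  by (metis linorder_neqE_nat)

text \<open>The recursion consults a plan only through its domain and through which steps share a
  user, so both plans take matching branches at every position. This transfers a pattern to a plan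
  that uses other users.\<close>

lemma pattern_entry_cong:
  assumes dom: "\<And>i. i < n \<Longrightarrow> ss ! i \<in> dom \<pi> \<and> ss ! i \<in> dom \<pi>'"
    and same: "\<And>i j. i < n \<Longrightarrow> j < n \<Longrightarrow> \<pi> (ss ! i) = \<pi> (ss ! j) \<longleftrightarrow> \<pi>' (ss ! i) = \<pi>' (ss ! j)"
    and "i < n"
  shows "pattern_entry ss \<pi> i = pattern_entry ss \<pi>' i"
  using \<open>i < n\<close>
proof (induction i rule: less_induct)
  case (less i)
  consider "i = 0" | j where "j < i" "\<pi> (ss ! i) = \<pi> (ss ! j)"
    | "i > 0" "\<And>j. j < i \<Longrightarrow> \<pi> (ss ! i) \<noteq> \<pi> (ss ! j)"
    by blast
  then show ?case
  proof cases
    case 1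
    then show ?thesis using dom less.prems by (simp add: pattern_entry_first)
  next
    case (2 j)
    then have "\<pi>' (ss ! i) = \<pi>' (ss ! j)" using same less.prems by (meson less_trans)
    \<comment> \<open>\<open>pattern_entry_same\<close> accepts any earlier step with the same user,
      so the least such indices of the two recursions need not be compared.\<close>
    with 2 show ?thesis
      using pattern_entry_same[of j i ss \<pi>] pattern_entry_same[of j i ss \<pi>'] dom less by simp
  next
    case 3
    have "\<pi>' (ss ! i) \<noteq> \<pi>' (ss ! j)" if "j < i" for j
      using 3(2)[OF that] same that less.prems by (meson less_trans)
    moreover have "pattern_entry ss \<pi> ` {..<i} = pattern_entry ss \<pi>' ` {..<i}"
      using less by (intro image_cong) auto
    ultimately show ?thesis
      using 3 dom less.prems by (simp add: pattern_entry_new)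
  qed
qed

text \<open>Disjoint edges have distinct left endpoints, so a matching with \<open>card X\<close>
  edges reaches every element of the finite set \<open>X\<close>. Its right endpoints then define
  \<open>f\<close>, and disjointness makes \<open>f\<close> injective.\<close>

lemma saturating_matching_iff:
  fixes X :: "'a set" and R :: "'a \<Rightarrow> 'b \<Rightarrow> bool"
  assumes "finite X"
  shows "(\<exists>M. is_matching (V, {{Inl x, Inr u} |x u. x \<in> X \<and> R x u}) M \<and> card M = card X)
    \<longleftrightarrow> (\<exists>f. inj_on f X \<and> (\<forall>x\<in>X. R x (f x)))"
    (is "?L \<longleftrightarrow> ?R")
proof
  assume ?L
  then obtain M where M: "M \<subseteq> {{Inl x, Inr u} |x u. x \<in> X \<and> R x u}"
    "pairwise disjnt M" "card M = card X"
    by (auto simp: is_matching_def)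
  \<comment> \<open>The left endpoint of an edge, well defined because each edge contains exactly
    one \<open>Inl\<close>.\<close>
  define g :: "('a + 'b) set \<Rightarrow> 'a" where "g e = (THE x. Inl x \<in> e)" for e
  have g: "g {Inl x, Inr u} = x" for x u by (auto simp: g_def)
  have meet: "e = e'" if "e \<in> M" "e' \<in> M" "v \<in> e" "v \<in> e'" for e e' v
    using M(2) that by (auto simp: pairwise_def disjnt_iff)
  have mem: "Inl (g e) \<in> e \<and> g e \<in> X" if "e \<in> M" for e
    using M(1) that g by auto
  have "inj_on g M" using meet mem by (metis inj_onI)
  then have "card (g ` M) = card X" using M(3) by (simp add: card_image)
  then have "g ` M = X" using mem assms by (intro card_subset_eq) auto
  have "\<exists>u. {Inl x, Inr u} \<in> M \<and> R x u" if "x \<in> X" for x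
  proof -
    obtain e where "e \<in> M" "x = g e" using \<open>g ` M = X\<close> \<open>x \<in> X\<close> by blast
    with M(1) g show ?thesis by fastforce
  qed
  then obtain f where f: "\<And>x. x \<in> X \<Longrightarrow> {Inl x, Inr (f x)} \<in> M \<and> R x (f x)" by metis
  have "inj_on f X"
  proof (rule inj_onI)
    fix x y assume "x \<in> X" "y \<in> X" "f x = f y"
    \<comment> \<open>Both edges contain \<open>Inr (f x)\<close>, and edges of \<open>M\<close>
      that meet are equal.\<close>
    then have "{Inl x, Inr (f x)} = {Inl y, Inr (f y)}"
      using f[of x] f[of y] by (intro meet[of _ _ "Inr (f x)"]) simp_all
    then show "x = y" using g by metis
  qed
  with f show ?R by blast
next
  assume ?R
  then obtain f where f: "inj_on f X" "\<And>x. x \<in> X \<Longrightarrow> R x (f x)" by blast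
  let ?M = "(\<lambda>x. {Inl x, Inr (f x)}) ` X"
  have "is_matching (V, {{Inl x, Inr u} |x u. x \<in> X \<and> R x u}) ?M"
    using f by (auto simp: is_matching_def pairwise_def disjnt_iff dest: inj_onD)
  moreover have "card ?M = card X"
    by (rule card_image) (auto simp: inj_on_def doubleton_eq_iff)
  ultimately show ?L by blast
qed

lemma authorised_pattern_iff_injective_choice:
  assumes "distinct ss" and P: "complete_pattern ss U P"
  shows "authorised_pattern ss U A P \<longleftrightarrow>
    (\<exists>f. inj_on f (set P) \<and>
      (\<forall>x\<in>set P. f x \<in> U \<and> (\<forall>s\<in>pattern_block ss P x. f x \<in> authorised_users U A s)))"
    (is "?L \<longleftrightarrow> ?R")
proof -
  have len: "length P = length ss"
    using P by (auto simp: complete_pattern_def is_pattern_def pattern_def)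
  have in_dom: "ss ! i \<in> dom \<pi>" if "pattern ss \<pi> = P" "i < length ss" for \<pi> :: "'a \<rightharpoonup> 'b" and i
  proof (rule ccontr)
    assume "ss ! i \<notin> dom \<pi>"
    then have "pattern ss \<pi> ! i = 0" using that(2) by (simp add: pattern_def pattern_entry_notin)
    then have "P ! i = 0" using that(1) by simp
    then show False using P that len nth_mem[of i P] by (auto simp: complete_pattern_def)
  qed
  have same: "P ! i = P ! j \<longleftrightarrow> \<pi> (ss ! i) = \<pi> (ss ! j)"
    if "pattern ss \<pi> = P" "i < length ss" "j < length ss" for \<pi> :: "'a \<rightharpoonup> 'b" and i j
    using pattern_entry_eq_iff[OF in_dom[OF that(1,2)] in_dom[OF that(1,3)]] that
    by (auto simp: pattern_def)
  show ?thesis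
  proof
    assume ?L
    then obtain \<pi> where \<pi>: "is_plan ss U \<pi>" "authorised_plan A \<pi>" "pattern ss \<pi> = P"
      by (auto simp: authorised_pattern_def)
    have "\<exists>i<length ss. P ! i = x" if "x \<in> set P" for x
      using that len by (metis in_set_conv_nth)
    \<comment> \<open>\<open>ix x\<close> picks a representative position in the block of
      \<open>x\<close>; since all steps of a block share a user, \<open>f\<close> read off there
      describes the whole plan.\<close>
    then obtain ix where ix: "\<And>x. x \<in> set P \<Longrightarrow> ix x < length ss \<and> P ! ix x = x"
      by metis
    define f where "f x = the (\<pi> (ss ! ix x))" for x
    have user: "\<pi> (ss ! i) = Some (f (P ! i))" if "i < length ss" for i
    proof -
      have "P ! i \<in> set P" using that len by simp
      with ix have "ix (P ! i) < length ss" "P ! ix (P ! i) = P ! i" by blast+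
      then have "\<pi> (ss ! ix (P ! i)) = \<pi> (ss ! i)" using same[OF \<pi>(3)] that by blast
      with in_dom[OF \<pi>(3) that] show ?thesis by (auto simp: f_def)
    qed
    have "inj_on f (set P)"
    proof (rule inj_onI)
      fix x y assume xy: "x \<in> set P" "y \<in> set P" "f x = f y"
      then have "\<pi> (ss ! ix x) = \<pi> (ss ! ix y)" using user ix by metis
      then show "x = y" using same[OF \<pi>(3)] ix xy by metis
    qed
    moreover have auth: "f (P ! i) \<in> authorised_users U A (ss ! i)" if "i < length ss" for i
      using user[OF that] \<pi>(1,2)
      by (force simp: authorised_users_def is_plan_def authorised_plan_def ran_def)
    moreover have "f x \<in> U" if "x \<in> set P" for x
      using auth[of "ix x"] ix[OF that] by (simp add: authorised_users_def)
    ultimately show ?R by (auto simp: pattern_block_def)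
  next
    assume ?R
    then obtain f where inj: "inj_on f (set P)" and U: "\<And>x. x \<in> set P \<Longrightarrow> f x \<in> U"
      and auth: "\<And>x s. x \<in> set P \<Longrightarrow> s \<in> pattern_block ss P x \<Longrightarrow> f x \<in> authorised_users U A s"
      by blast
    \<comment> \<open>A reference plan, possibly unauthorised, witnessing that \<open>P\<close> is a
      pattern; the authorised plan built from \<open>f\<close> is compared with it.\<close>
    obtain \<pi>0 :: "'a \<rightharpoonup> 'b" where \<pi>0: "pattern ss \<pi>0 = P"
      using P by (auto simp: complete_pattern_def is_pattern_def)
    define \<pi> where "\<pi> = map_of (zip ss (map f P))"
    have user: "\<pi> (ss ! i) = Some (f (P ! i))" if "i < length ss" for i
      using that len \<open>distinct ss\<close> by (simp add: \<pi>_def map_of_zip_nth)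
    have dom: "dom \<pi> = set ss" using len by (simp add: \<pi>_def)
    have ix: "\<exists>i<length ss. s = ss ! i \<and> \<pi> s = Some (f (P ! i))" if "s \<in> dom \<pi>" for s
      using that user dom by (metis in_set_conv_nth)
    have "ran \<pi> \<subseteq> U"
    proof
      fix u assume "u \<in> ran \<pi>"
      then obtain s where "\<pi> s = Some u" by (auto simp: ran_def)
      then obtain i where "i < length ss" "u = f (P ! i)" using ix[OF domI] by fastforce
      with U len show "u \<in> U" by simp
    qed
    then have "is_plan ss U \<pi>" using dom by (simp add: is_plan_def)
    moreover have "authorised_plan A \<pi>"
      unfolding authorised_plan_def
    proof
      fix s assume "s \<in> dom \<pi>"
      then obtain i where i: "i < length ss" "s = ss ! i" "\<pi> s = Some (f (P ! i))"
        using ix by blast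
      then have "f (P ! i) \<in> authorised_users U A s"
        using len by (intro auth) (auto simp: pattern_block_def)
      with i show "s \<in> A (the (\<pi> s))" by (simp add: authorised_users_def)
    qed
    moreover have "pattern ss \<pi> = pattern ss \<pi>0"
    proof -
      have "pattern_entry ss \<pi> i = pattern_entry ss \<pi>0 i" if "i < length ss" for i
      proof (rule pattern_entry_cong[OF _ _ that])
        fix i assume "i < length ss"
        then show "ss ! i \<in> dom \<pi> \<and> ss ! i \<in> dom \<pi>0" using dom in_dom[OF \<pi>0] by simp
      next
        fix i j assume "i < length ss" "j < length ss"
        then show "\<pi> (ss ! i) = \<pi> (ss ! j) \<longleftrightarrow> \<pi>0 (ss ! i) = \<pi>0 (ss ! j)"
          \<comment> \<open>Both sides amount to \<open>P ! i = P ! j\<close>: for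
            \<open>\<pi>\<close> by injectivity of \<open>f\<close>, for \<open>\<pi>0\<close> by
            \<open>same\<close>.\<close>
          using user same[OF \<pi>0] inj len by (simp add: inj_on_eq_iff)
      qed
      then show ?thesis by (simp add: pattern_def)
    qed
    ultimately show ?L using \<pi>0 by (auto simp: authorised_pattern_def)
  qed
qed

theorem theorem1:
  fixes ss :: "'s list" and U :: "'u set" and A :: "'u \<Rightarrow> 's set" and P :: "nat list"
  assumes "distinct ss"
    and "finite U"
    and "\<And>u. u \<in> U \<Longrightarrow> A u \<subseteq> set ss"
    and "complete_pattern ss U P"
  shows "authorised_pattern ss U A P \<longleftrightarrow>
    (\<exists>M. is_matching (pattern_graph ss U A P) M \<and> card M = card (set P))"
  \<comment> \<open>With \<open>R x u\<close> read as the edge condition, including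
    \<open>u \<in> U\<close>, both sides become the existence of the same injective choice
    \<open>f\<close>.\<close>
  unfolding pattern_graph_def
    authorised_pattern_iff_injective_choice[OF assms(1,4)]
    saturating_matching_iff[OF finite_set] ..

end
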